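(* Let $n$ be even and let $f:\{0,1\}^n\to\{0,1\}$ be the Boolean function represented by the read-once DNF formula $t_1\vee t_2\vee\dots\vee t_{n/2}$, where $t_i=x_i x_{n/2+i}$. Then the $Q$-value of $f$ is at least $2^{n/2}$.
   Context: A partial assignment is $b\in\{0,1,*\}^n$. For partial assignments $a,b$, $a\sim b$ means $a_i=b_i$ whenever $b_i\ne *$. For $l\in\{0,1\}$, $b_{x_i\leftarrow l}$ is $b$ with its $i$-th coordinate set to $l$. $b$ is a $0$-certificate ($1$-certificate) of $f$ if $f(a)=0$ ($f(a)=1$) for all $a\in\{0,1\}^n$ with $a\sim b$. A utility function $g:\{0,1,*\}^n\to\mathbb{Z}_{\ge0}$ is monotone if $g(b_{x_i\leftarrow l})\ge g(b)$ whenever $b_i=*$, $l\in\{0,1\}$; submodular if $g(b_{x_i\leftarrow l})-g(b)\ge g(b'_{x_i\leftarrow l})-g(b')$ whenever $b'\sim b$, $b_i=b'_i=*$, $l\in\{0,1\}$. $g$ is assignment feasible for $f$ with goal value $Q$ if $g$ is monotone and submodular, $g( *,\dots,* )=0$, and for all $b$, $g(b)=Q$ iff $b$ is a $0$-certificate or a $1$-certificate of $f$. The $Q$-value of $f$ is the minimum integer $Q$ such that some integer-valued utility function is assignment feasible for $f$ with goal value $Q$. *)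

theory Defs
  imports Main
begin

text \<open>
  A partial assignment in \<open>{0,1,*}\<^sup>n\<close> is a map on the indices \<open>1,\<dots>,n\<close>, with \<open>b i = None\<close>
  encoding \<open>b\<^sub>i = *\<close>. Then \<open>a \<sim> b\<close> is the library relation \<open>b \<subseteq>\<^sub>m a\<close> (note the order),
  setting a coordinate is the map update \<open>b(i \<mapsto> l)\<close>, and \<open>(*,\<dots>,*)\<close> is \<open>Map.empty\<close>.
  Functions on (partial) assignments are only ever inspected on the two sets below.
\<close>

type_synonym assignment = "nat \<rightharpoonup> bool"

definition partial_assignments :: "nat \<Rightarrow> assignment set" where
  "partial_assignments n = {b. dom b \<subseteq> {1..n}}"

definition full_assignments :: "nat \<Rightarrow> assignment set" where
  "full_assignments n = {a. dom a = {1..n}}"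

definition certificate :: "nat \<Rightarrow> (assignment \<Rightarrow> bool) \<Rightarrow> bool \<Rightarrow> assignment \<Rightarrow> bool" where
  "certificate n f v b \<longleftrightarrow> (\<forall>a\<in>full_assignments n. b \<subseteq>\<^sub>m a \<longrightarrow> f a = v)"

definition utility_monotone :: "nat \<Rightarrow> (assignment \<Rightarrow> nat) \<Rightarrow> bool" where
  "utility_monotone n g \<longleftrightarrow>
     (\<forall>b\<in>partial_assignments n. \<forall>i\<in>{1..n}. \<forall>l. b i = None \<longrightarrow> g (b(i \<mapsto> l)) \<ge> g b)"

definition utility_submodular :: "nat \<Rightarrow> (assignment \<Rightarrow> nat) \<Rightarrow> bool" where
  "utility_submodular n g \<longleftrightarrow>
     (\<forall>b\<in>partial_assignments n. \<forall>b'\<in>partial_assignments n. \<forall>i\<in>{1..n}. \<forall>l.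
        b \<subseteq>\<^sub>m b' \<and> b i = None \<and> b' i = None \<longrightarrow>
        int (g (b(i \<mapsto> l))) - int (g b) \<ge> int (g (b'(i \<mapsto> l))) - int (g b'))"

definition assignment_feasible ::
    "nat \<Rightarrow> (assignment \<Rightarrow> bool) \<Rightarrow> (assignment \<Rightarrow> nat) \<Rightarrow> nat \<Rightarrow> bool" where
  "assignment_feasible n f g Q \<longleftrightarrow>
     utility_monotone n g \<and> utility_submodular n g \<and> g Map.empty = 0 \<and>
     (\<forall>b\<in>partial_assignments n.
        g b = Q \<longleftrightarrow> certificate n f False b \<or> certificate n f True b)"

text \<open>
  Taking \<open>Q\<close> in \<^typ>\<open>nat\<close> loses nothing: every full assignment is a certificate, so a goal
  value is always attained by the non-negative function \<open>g\<close>.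
\<close>

definition Q_value :: "nat \<Rightarrow> (assignment \<Rightarrow> bool) \<Rightarrow> nat" where
  "Q_value n f = (LEAST Q. \<exists>g. assignment_feasible n f g Q)"

end

theory Submission
  imports Defs
begin

text \<open>
  Write \<open>D(b) = Q - g(b)\<close> for the deficiency of a feasible \<open>g\<close>. Once \<open>x\<^sub>i = 1\<close>, setting
  \<open>x\<^bsub>n/2+i\<^esub> = 1\<close> completes a certificate and so removes the whole deficiency; by submodularity,
  \<open>D(b) \<ge> D(b(i \<mapsto> True)) + D(b(n/2+i \<mapsto> True))\<close> as long as both variables of \<open>t\<^sub>i\<close> are unset.
  Iterating over the terms bounds \<open>Q = D(*,\<dots>,*)\<close> from below by a sum over \<open>2\<^bsup>n/2\<^esup>\<close> partial
  assignments, each with exactly one variable of each term set to \<open>1\<close>. None of these is a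
  certificate, so each has deficiency at least \<open>1\<close>.

  As the minimum in the definition of the \<open>Q\<close>-value is a \<open>LEAST\<close>, it must also be shown that some
  feasible \<open>g\<close> exists. Counting the pairs of a \<open>1\<close>-point and a \<open>0\<close>-point of \<open>f\<close> that \<open>b\<close>
  does not extend to simultaneously is feasible for any \<open>f\<close>.
\<close>

lemma map_le_fun_upd_iff:
  assumes "b i = None"
  shows "b(i \<mapsto> l) \<subseteq>\<^sub>m a \<longleftrightarrow> b \<subseteq>\<^sub>m a \<and> a i = Some l"
proof
  assume upd: "b(i \<mapsto> l) \<subseteq>\<^sub>m a"
  moreover have "b \<subseteq>\<^sub>m b(i \<mapsto> l)"
    using assms by (auto simp: map_le_def)
  ultimately show "b \<subseteq>\<^sub>m a \<and> a i = Some l"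
    by (metis domI fun_upd_same map_le_def map_le_trans)
qed (auto simp: map_le_def)

lemma finite_full_assignments: "finite (full_assignments n)"
  using finite_set_of_finite_maps[of "{1..n}" "UNIV :: bool set"]
  by (simp add: full_assignments_def)

definition separating_pairs :: "nat \<Rightarrow> (assignment \<Rightarrow> bool) \<Rightarrow> (assignment \<times> assignment) set" where
  "separating_pairs n f = {a \<in> full_assignments n. f a} \<times> {a \<in> full_assignments n. \<not> f a}"

definition refuted_pairs ::
    "nat \<Rightarrow> (assignment \<Rightarrow> bool) \<Rightarrow> assignment \<Rightarrow> (assignment \<times> assignment) set" where
  "refuted_pairs n f b = {p \<in> separating_pairs n f. \<not> (b \<subseteq>\<^sub>m fst p \<and> b \<subseteq>\<^sub>m snd p)}"

lemma finite_separating_pairs: "finite (separating_pairs n f)"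
  by (simp add: separating_pairs_def finite_full_assignments)

lemma finite_refuted_pairs: "finite (refuted_pairs n f b)"
  by (simp add: refuted_pairs_def finite_separating_pairs)

lemma refuted_pairs_mono: "b \<subseteq>\<^sub>m b' \<Longrightarrow> refuted_pairs n f b \<subseteq> refuted_pairs n f b'"
  by (auto simp: refuted_pairs_def dest: map_le_trans)

text \<open>Expressing the gain as the size of a set difference makes it visibly nonnegative and
  reduces submodularity to an inclusion of sets.\<close>

lemma card_refuted_pairs_fun_upd:
  assumes "b i = None"
  shows "card (refuted_pairs n f (b(i \<mapsto> l))) =
    card (refuted_pairs n f b) + card (refuted_pairs n f (b(i \<mapsto> l)) - refuted_pairs n f b)"
proof -
  have "refuted_pairs n f b \<subseteq> refuted_pairs n f (b(i \<mapsto> l))"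
    using assms by (intro refuted_pairs_mono) (auto simp: map_le_def)
  then show ?thesis
    by (simp add: card_Diff_subset card_mono finite_refuted_pairs)
qed

text \<open>A pair newly refuted over \<open>b'\<close> has both components extending
  \<open>b'\<close>, hence \<open>b\<close>, while one of them disagrees with \<open>l\<close> at
  \<open>i\<close>. So the same update also newly refutes it over \<open>b\<close>.\<close>

lemma refuted_pairs_gain_antimono:
  assumes "b \<subseteq>\<^sub>m b'" and "b i = None" and "b' i = None"
  shows "refuted_pairs n f (b'(i \<mapsto> l)) - refuted_pairs n f b'
    \<subseteq> refuted_pairs n f (b(i \<mapsto> l)) - refuted_pairs n f b"
proof
  fix p
  assume p: "p \<in> refuted_pairs n f (b'(i \<mapsto> l)) - refuted_pairs n f b'"
  then have "b' \<subseteq>\<^sub>m fst p" "b' \<subseteq>\<^sub>m snd p"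
    by (auto simp: refuted_pairs_def)
  moreover from this have "b \<subseteq>\<^sub>m fst p" "b \<subseteq>\<^sub>m snd p"
    using assms(1) map_le_trans by auto
  ultimately show "p \<in> refuted_pairs n f (b(i \<mapsto> l)) - refuted_pairs n f b"
    using p assms(2,3) by (simp add: refuted_pairs_def map_le_fun_upd_iff)
qed

text \<open>An unrefuted pair is a 1-point and a 0-point of \<open>f\<close> both extending
  \<open>b\<close>, which is exactly what keeps \<open>b\<close> from being a certificate of either
  kind.\<close>

lemma refuted_pairs_eq_iff_certificate:
  "refuted_pairs n f b = separating_pairs n f \<longleftrightarrow>
    certificate n f False b \<or> certificate n f True b"
proof -
  have "refuted_pairs n f b = separating_pairs n f \<longleftrightarrow>
      (\<forall>p\<in>separating_pairs n f. \<not> (b \<subseteq>\<^sub>m fst p \<and> b \<subseteq>\<^sub>m snd p))"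
    unfolding refuted_pairs_def by blast
  also have "\<dots> \<longleftrightarrow> (\<forall>a\<in>full_assignments n. \<forall>a'\<in>full_assignments n.
      f a \<longrightarrow> \<not> f a' \<longrightarrow> \<not> (b \<subseteq>\<^sub>m a \<and> b \<subseteq>\<^sub>m a'))"
    by (simp add: separating_pairs_def Ball_def) blast
  also have "\<dots> \<longleftrightarrow> certificate n f False b \<or> certificate n f True b"
    unfolding certificate_def by blast
  finally show ?thesis .
qed

lemma assignment_feasible_refuted_pairs:
  "assignment_feasible n f (\<lambda>b. card (refuted_pairs n f b)) (card (separating_pairs n f))"
  unfolding assignment_feasible_def
proof (intro conjI ballI)
  show "utility_monotone n (\<lambda>b. card (refuted_pairs n f b))"
    by (simp add: utility_monotone_def card_refuted_pairs_fun_upd)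
  show "utility_submodular n (\<lambda>b. card (refuted_pairs n f b))"
    unfolding utility_submodular_def
    by (clarsimp simp: card_refuted_pairs_fun_upd)
      (intro card_mono refuted_pairs_gain_antimono finite_Diff finite_refuted_pairs)
  show "card (refuted_pairs n f Map.empty) = 0"
    by (simp add: refuted_pairs_def)
  have "card (refuted_pairs n f b) = card (separating_pairs n f) \<longleftrightarrow>
      refuted_pairs n f b = separating_pairs n f" for b
    using card_subset_eq[OF finite_separating_pairs, of "refuted_pairs n f b" n f]
    by (auto simp: refuted_pairs_def)
  then show "card (refuted_pairs n f b) = card (separating_pairs n f) \<longleftrightarrow>
      certificate n f False b \<or> certificate n f True b" for b
    by (simp add: refuted_pairs_eq_iff_certificate)
qed

lemma Q_value_feasible: "\<exists>g. assignment_feasible n f g (Q_value n f)"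
  unfolding Q_value_def by (rule LeastI) (rule exI, rule assignment_feasible_refuted_pairs)

text \<open>Induction invariant: the first \<open>k\<close> terms are untouched, and each later one
  has exactly one variable set, to \<open>True\<close>. Having \<open>g b\<close> on the left avoids
  truncated subtraction in the deficiency.\<close>

lemma two_power_le_deficiency:
  fixes m k :: nat and b :: assignment
  assumes f: "\<And>a. a \<in> full_assignments (2 * m) \<Longrightarrow>
      f a \<longleftrightarrow> (\<exists>i\<in>{1..m}. a i = Some True \<and> a (m + i) = Some True)"
    and feasible: "assignment_feasible (2 * m) f g Q"
    and "m > 0" and "k \<le> m" and "dom b \<subseteq> {1..2 * m}"
    and "\<And>i. i \<in> {1..k} \<Longrightarrow> b i = None \<and> b (m + i) = None"
    and "\<And>i. i \<in> {k<..m} \<Longrightarrow>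
      b i = Some True \<and> b (m + i) = None \<or> b i = None \<and> b (m + i) = Some True"
  shows "2 ^ k + g b \<le> Q"
  using assms(4-)
proof (induction k arbitrary: b)
  have goal: "g c = Q \<longleftrightarrow> certificate (2 * m) f False c \<or> certificate (2 * m) f True c"
    if "dom c \<subseteq> {1..2 * m}" for c
    using feasible that by (simp add: assignment_feasible_def partial_assignments_def)
  have term_true: "g c = Q"
    if "dom c \<subseteq> {1..2 * m}" "i \<in> {1..m}" "c i = Some True" "c (m + i) = Some True" for c i
  proof -
    have "f a" if "a \<in> full_assignments (2 * m)" "c \<subseteq>\<^sub>m a" for a
      using f[OF that(1)] that(2) \<open>i \<in> _\<close> \<open>c i = _\<close> \<open>c (m + i) = _\<close>
      by (metis domI map_le_def)
    then show ?thesis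
      using goal[OF \<open>dom c \<subseteq> _\<close>] by (simp add: certificate_def)
  qed
  {
    case 0
    \<comment> \<open>\<open>a1\<close> is the all-true point, and \<open>a0\<close> fills the free
      variables of \<open>b\<close> with \<open>False\<close>. Together they witness that
      \<open>b\<close> is not a certificate.\<close>
    define a1 :: assignment where "a1 j = (if j \<in> {1..2 * m} then Some True else None)" for j
    define a0 :: assignment where
      "a0 j = (if j \<in> {1..2 * m} then Some (b j = Some True) else None)" for j
    \<comment> \<open>No variable of \<open>b\<close> is set to \<open>False\<close>, which is what
      lets \<open>a1\<close> extend \<open>b\<close>.\<close>
    have b_True: "v" if "b j = Some v" for j v
    proof -
      have "j \<in> {1..2 * m}" using that 0 by blast
      show ?thesis
      proof (cases "j \<le> m")
        case True
        then show ?thesis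
          using that 0(4)[of j] \<open>j \<in> {1..2 * m}\<close> by auto
      next
        case False
        then have "j = m + (j - m)" "j - m \<in> {0<..m}"
          using \<open>j \<in> {1..2 * m}\<close> by auto
        then show ?thesis
          using that 0(4)[of "j - m"] by auto
      qed
    qed
    have full: "a1 \<in> full_assignments (2 * m)" "a0 \<in> full_assignments (2 * m)"
      by (auto simp: full_assignments_def a1_def a0_def dom_def)
    have le: "b \<subseteq>\<^sub>m a1" "b \<subseteq>\<^sub>m a0"
      using 0(2) b_True by (auto simp: map_le_def a1_def a0_def subset_iff)
    have "f a1"
    proof -
      have "1 \<in> {1..m}" "a1 1 = Some True" "a1 (m + 1) = Some True"
        using \<open>m > 0\<close> by (auto simp: a1_def)
      then show ?thesis
        using f[OF full(1)] by blast
    qed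
    moreover have "\<not> f a0"
    proof -
      have "\<not> (a0 i = Some True \<and> a0 (m + i) = Some True)" if "i \<in> {1..m}" for i
        using 0(4)[of i] that by (auto simp: a0_def)
      then show ?thesis
        using f[OF full(2)] by blast
    qed
    ultimately have "g b \<noteq> Q"
      using goal[OF 0(2)] full le by (auto simp: certificate_def)
    \<comment> \<open>Setting the missing variable of the first term, which exists since
      \<open>m > 0\<close>, reaches the value \<open>Q\<close>; monotonicity then bounds
      \<open>g b\<close>.\<close>
    moreover have "g b \<le> Q"
    proof -
      obtain j where j: "j \<in> {1, m + 1}" "b j = None"
          "(b(j \<mapsto> True)) 1 = Some True" "(b(j \<mapsto> True)) (m + 1) = Some True"
        using 0(4)[of 1] \<open>m > 0\<close> that[of 1] that[of "m + 1"] by auto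
      then have "j \<in> {1..2 * m}" using \<open>m > 0\<close> by auto
      then have "g (b(j \<mapsto> True)) = Q"
        using j 0(2) \<open>m > 0\<close> by (intro term_true[of _ 1]) auto
      moreover have "g b \<le> g (b(j \<mapsto> True))"
        using feasible 0(2) j(2) \<open>j \<in> {1..2 * m}\<close>
        by (simp add: assignment_feasible_def utility_monotone_def partial_assignments_def)
      ultimately show ?thesis by simp
    qed
    ultimately show ?case by simp
  next
    case (Suc k)
    define i where "i = Suc k"
    let ?x = "b(i \<mapsto> True)" and ?y = "b(m + i \<mapsto> True)"
    have i: "i \<in> {1..m}" "b i = None" "b (m + i) = None" "m + i \<in> {1..2 * m}"
      using Suc.prems(1) Suc.prems(3)[of i] by (auto simp: i_def)
    \<comment> \<open>Either update turns term \<open>i\<close> from untouched to half-set, so both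
      \<open>?x\<close> and \<open>?y\<close> satisfy the invariant for \<open>k\<close>.\<close>
    have rest: "c j = Some True \<and> c (m + j) = None \<or> c j = None \<and> c (m + j) = Some True"
      if "c = ?x \<or> c = ?y" "j \<in> {k<..m}" for c j
    proof (cases "j = i")
      case True
      then show ?thesis using that(1) i \<open>m > 0\<close> by auto
    next
      case False
      then show ?thesis
        using that i Suc.prems(4)[of j] by (auto simp: i_def)
    qed
    have bound: "2 ^ k + g c \<le> Q" if "c = ?x \<or> c = ?y" for c
    proof (rule Suc.IH)
      show "k \<le> m" using Suc.prems(1) by simp
      show "dom c \<subseteq> {1..2 * m}"
        by (rule disjE[OF that]) (use i(1,4) Suc.prems(2) in simp_all)
      show "c j = None \<and> c (m + j) = None" if "j \<in> {1..k}" for j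
        using \<open>c = ?x \<or> c = ?y\<close> that i Suc.prems(3)[of j] by (auto simp: i_def)
    qed (rule rest[OF that])
    have "g (?x(m + i \<mapsto> True)) = Q"
      using i Suc.prems(2) by (intro term_true[of _ i]) auto
    \<comment> \<open>At \<open>?x\<close>, setting \<open>m + i\<close> gains all of
      \<open>Q - g ?x\<close>; the smaller assignment \<open>b\<close> gains at least as much. Hence
      the deficiencies of \<open>?x\<close> and \<open>?y\<close>, each at least
      \<open>2 ^ k\<close>, add up to at most that of \<open>b\<close>.\<close>
    moreover have "int (g ?y) - int (g b) \<ge> int (g (?x(m + i \<mapsto> True))) - int (g ?x)"
    proof -
      have "b \<subseteq>\<^sub>m ?x" "?x (m + i) = None"
        using i \<open>m > 0\<close> by (auto simp: map_le_def)
      moreover have "b \<in> partial_assignments (2 * m)" "?x \<in> partial_assignments (2 * m)"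
        using Suc.prems(2) i by (auto simp: partial_assignments_def)
      ultimately show ?thesis
        using feasible i unfolding assignment_feasible_def utility_submodular_def by blast
    qed
    ultimately show ?case
      using bound[of ?x] bound[of ?y] by simp
  }
qed

theorem theorem2:
  fixes n :: nat and f :: "assignment \<Rightarrow> bool"
  assumes "even n" and "n > 0"
    and "\<And>a. a \<in> full_assignments n \<Longrightarrow>
           f a \<longleftrightarrow> (\<exists>i\<in>{1..n div 2}. a i = Some True \<and> a (n div 2 + i) = Some True)"
  shows "Q_value n f \<ge> 2 ^ (n div 2)"
proof -
  obtain m where n: "n = 2 * m"
    using \<open>even n\<close> by blast
  obtain g where "assignment_feasible (2 * m) f g (Q_value n f)"
    using Q_value_feasible n by blast
  \<comment> \<open>With \<open>k = m\<close> every term is untouched, so the empty assignment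
    satisfies the invariant.\<close>
  then have "2 ^ m + g Map.empty \<le> Q_value n f"
    using assms(2,3) n by (intro two_power_le_deficiency[where f = f and m = m]) auto
  then show ?thesis
    using n by simp
qed

end
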